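(* Let $G$ be a finite connected graph, and consider the Robber Locating Game on $G$ with a fixed number of cops. Let $A$ be a deterministic cop strategy, and let $H_A$ be its cop strategy graph. Then $A$ is cop-winning if and only if $H_A$ is finite.
   Context: Robber Locating Game: an invisible robber first chooses a vertex of $G$. In each round, the cops first simultaneously probe vertices anywhere in $G$, each probe returning the graph distance from the probed vertex to the robber's current position; then the robber moves to an adjacent vertex or stays put. The robber set $R_i$ is the set of positions of the robber consistent with all information after the cops' probes in round $i$ (and before the robber moves); the extended robber set after the robber moves is $X_i$, the closed neighbourhood of $R_i$, with $X_0=V(G)$. The cops win when $|R_i|=1$. A strategy is cop-winning if it guarantees a win for the cops in finite time against every robber behaviour. A state $\phi$ is the collection of information available to the cops that may affect their probes (e.g. the (extended) robber set, round number, previous probe results); a deterministic cop strategy $A$ is a function assigning to each state the set of probes $A(\phi)$, with different probes exactly when states differ. The cop strategy graph $H_A$ is the rooted levelled graph whose vertices are states: it starts with the initial state, and there is an edge from a state $\phi_1$ on one level to a state $\phi_2$ on the next level, labelled by probe results, if and only if there is a valid set of probe results for the probes $A(\phi_1)$ that updates the state $\phi_1$ to $\phi_2$. A state is a leaf if and only if it is terminating, i.e. its robber set has size $1$. *)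

theory Defs
  imports "Graph_Theory.Graph_Theory"
begin

text \<open>
  A state consists of the current robber set together with any further information \<open>info\<close> of
  arbitrary type (round number, earlier probes and results, ...) on which the cops may base their
  probes. How \<open>info\<close> starts and evolves is a parameter: \<open>m0\<close> is its initial value, and
  \<open>upd \<phi> r\<close> its value after the probe results \<open>r\<close> have been received in state \<open>\<phi>\<close>.
  The robber set before the first round is the whole vertex set; its closed neighbourhood is then
  \<open>X\<^sub>0 = V(G)\<close>.
\<close>

record ('v, 'm) state =
  robber_set :: "'v set"
  info :: 'm

text \<open>The probed vertices are the domain of the map.\<close>

type_synonym 'v results = "'v \<rightharpoonup> ereal"

type_synonym ('v, 'm) strategy = "('v, 'm) state \<Rightarrow> 'v set"

type_synonym ('v, 'm) info_update = "('v, 'm) state \<Rightarrow> 'v results \<Rightarrow> 'm"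

definition graph_dist :: "('v, 'e) pre_digraph \<Rightarrow> 'v \<Rightarrow> 'v \<Rightarrow> ereal" where
  "graph_dist G u v = wf_digraph.\<mu> G (\<lambda>_. 1) u v"

definition closed_nbhd :: "('v, 'e) pre_digraph \<Rightarrow> 'v set \<Rightarrow> 'v set" where
  "closed_nbhd G S = S \<union> {v. \<exists>u\<in>S. u \<rightarrow>\<^bsub>G\<^esub> v}"

definition probe_results :: "('v, 'e) pre_digraph \<Rightarrow> 'v set \<Rightarrow> 'v \<Rightarrow> 'v results" where
  "probe_results G P v = (\<lambda>p. if p \<in> P then Some (graph_dist G p v) else None)"

text \<open>Several cops may probe the same vertex, so \<open>k\<close> cops probe a set of at most \<open>k\<close> vertices.\<close>

definition cop_strategy :: "('v, 'e) pre_digraph \<Rightarrow> nat \<Rightarrow> ('v, 'm) strategy \<Rightarrow> bool" where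
  "cop_strategy G k A \<longleftrightarrow> (\<forall>\<phi>. A \<phi> \<subseteq> verts G \<and> card (A \<phi>) \<le> k)"

definition initial_state :: "('v, 'e) pre_digraph \<Rightarrow> 'm \<Rightarrow> ('v, 'm) state" where
  "initial_state G m0 = \<lparr>robber_set = verts G, info = m0\<rparr>"

definition extended_robber_set :: "('v, 'e) pre_digraph \<Rightarrow> ('v, 'm) state \<Rightarrow> 'v set" where
  "extended_robber_set G \<phi> = closed_nbhd G (robber_set \<phi>)"

definition valid_results ::
    "('v, 'e) pre_digraph \<Rightarrow> ('v, 'm) strategy \<Rightarrow> ('v, 'm) state \<Rightarrow> 'v results set" where
  "valid_results G A \<phi> = probe_results G (A \<phi>) ` extended_robber_set G \<phi>"

definition next_state ::
    "('v, 'e) pre_digraph \<Rightarrow> ('v, 'm) info_update \<Rightarrow> ('v, 'm) strategy \<Rightarrow>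
      ('v, 'm) state \<Rightarrow> 'v results \<Rightarrow> ('v, 'm) state" where
  "next_state G upd A \<phi> r =
    \<lparr>robber_set = {v \<in> extended_robber_set G \<phi>. probe_results G (A \<phi>) v = r},
     info = upd \<phi> r\<rparr>"

definition terminating :: "('v, 'm) state \<Rightarrow> bool" where
  "terminating \<phi> \<longleftrightarrow> card (robber_set \<phi>) = 1"

text \<open>
  \<open>w i\<close> is the robber's position when the cops probe in round \<open>i + 1\<close>. Against a deterministic
  strategy every behaviour of the robber, adaptive or not, results in such a walk.
\<close>

definition robber_walk :: "('v, 'e) pre_digraph \<Rightarrow> (nat \<Rightarrow> 'v) \<Rightarrow> bool" where
  "robber_walk G w \<longleftrightarrow> w 0 \<in> verts G \<and> (\<forall>i. w (Suc i) \<in> closed_nbhd G {w i})"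

text \<open>The state after \<open>i\<close> rounds of probes against a robber following \<open>w\<close>.\<close>

primrec play_state ::
    "('v, 'e) pre_digraph \<Rightarrow> 'm \<Rightarrow> ('v, 'm) info_update \<Rightarrow> ('v, 'm) strategy \<Rightarrow>
      (nat \<Rightarrow> 'v) \<Rightarrow> nat \<Rightarrow> ('v, 'm) state" where
  "play_state G m0 upd A w 0 = initial_state G m0"
| "play_state G m0 upd A w (Suc i) =
    (let \<phi> = play_state G m0 upd A w i
     in next_state G upd A \<phi> (probe_results G (A \<phi>) (w i)))"

definition cop_winning ::
    "('v, 'e) pre_digraph \<Rightarrow> 'm \<Rightarrow> ('v, 'm) info_update \<Rightarrow> ('v, 'm) strategy \<Rightarrow> bool" where
  "cop_winning G m0 upd A \<longleftrightarrow>
    (\<forall>w. robber_walk G w \<longrightarrow>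
      (\<exists>i\<ge>1. card (robber_set (play_state G m0 upd A w i)) = 1))"

text \<open>
  A vertex of the strategy graph is a state tagged with its level: equal states on different
  levels are different vertices.
\<close>

inductive_set strategy_graph_verts ::
    "('v, 'e) pre_digraph \<Rightarrow> 'm \<Rightarrow> ('v, 'm) info_update \<Rightarrow> ('v, 'm) strategy \<Rightarrow>
      (nat \<times> ('v, 'm) state) set"
  for G m0 upd A where
  root: "(0, initial_state G m0) \<in> strategy_graph_verts G m0 upd A"
| child: "\<lbrakk>(i, \<phi>) \<in> strategy_graph_verts G m0 upd A; \<not> terminating \<phi>; r \<in> valid_results G A \<phi>\<rbrakk>
    \<Longrightarrow> (Suc i, next_state G upd A \<phi> r) \<in> strategy_graph_verts G m0 upd A"

text \<open>An arc is a triple of source, label and target.\<close>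

definition cop_strategy_graph ::
    "('v, 'e) pre_digraph \<Rightarrow> 'm \<Rightarrow> ('v, 'm) info_update \<Rightarrow> ('v, 'm) strategy \<Rightarrow>
      (nat \<times> ('v, 'm) state,
       (nat \<times> ('v, 'm) state) \<times> 'v results \<times> (nat \<times> ('v, 'm) state)) pre_digraph" where
  "cop_strategy_graph G m0 upd A =
    \<lparr>verts = strategy_graph_verts G m0 upd A,
     arcs = {((i, \<phi>), r, (Suc i, next_state G upd A \<phi> r)) | i \<phi> r.
       (i, \<phi>) \<in> strategy_graph_verts G m0 upd A \<and> \<not> terminating \<phi> \<and> r \<in> valid_results G A \<phi>},
     tail = fst,
     head = snd \<circ> snd\<rparr>"

text \<open>
  The robber set computed step by step is the set of all positions that are consistent with
  the results of all probes so far.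
\<close>

lemma closed_nbhd_verts:
  assumes "wf_digraph G"
  shows "closed_nbhd G (verts G) = verts G"
  using assms unfolding closed_nbhd_def by (auto dest: wf_digraph.adj_in_verts)

lemma robber_set_play_state:
  assumes G: "wf_digraph G"
  shows "robber_set (play_state G m0 upd A w (Suc n)) =
    {w' n | w'. robber_walk G w' \<and>
      (\<forall>j\<le>n. let P = A (play_state G m0 upd A w j)
              in probe_results G P (w' j) = probe_results G P (w j))}"
    (is "?R n = {w' n | w'. robber_walk G w' \<and> (\<forall>j\<le>n. ?C j (w' j))}")
proof (induction n)
  case 0
  have "{v \<in> verts G. ?C 0 v} \<subseteq> {w' 0 | w'. robber_walk G w' \<and> ?C 0 (w' 0)}"
  proof
    fix v assume v: "v \<in> {v \<in> verts G. ?C 0 v}"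
    then have "robber_walk G (\<lambda>_. v)" by (auto simp: robber_walk_def closed_nbhd_def)
    with v show "v \<in> {w' 0 | w'. robber_walk G w' \<and> ?C 0 (w' 0)}"
      by (intro CollectI exI[of _ "\<lambda>_. v"]) auto
  qed
  then have "{v \<in> verts G. ?C 0 v} = {w' 0 | w'. robber_walk G w' \<and> ?C 0 (w' 0)}"
    by (auto simp: robber_walk_def)
  then show ?case
    using closed_nbhd_verts[OF G]
    by (simp add: next_state_def initial_state_def extended_robber_set_def Let_def)
next
  case (Suc n)
  have R: "?R (Suc n) = {v \<in> closed_nbhd G (?R n). ?C (Suc n) v}"
    by (simp add: next_state_def extended_robber_set_def Let_def)
  show ?case
  proof (intro equalityI subsetI)
    fix v assume "v \<in> ?R (Suc n)"
    then have v: "v \<in> closed_nbhd G (?R n)" "?C (Suc n) v" unfolding R by auto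
    then obtain u where u: "u \<in> ?R n" "v \<in> closed_nbhd G {u}" by (auto simp: closed_nbhd_def)
    from u(1) obtain w' where w': "u = w' n" "robber_walk G w'" "\<forall>j\<le>n. ?C j (w' j)"
      unfolding Suc.IH by blast
    let ?w = "\<lambda>j. if j \<le> n then w' j else v"
    have "robber_walk G ?w"
      unfolding robber_walk_def
    proof (intro conjI allI)
      show "?w 0 \<in> verts G" using w'(2) by (simp add: robber_walk_def)
      fix i
      consider "Suc i \<le> n" | "i = n" | "i > n" by linarith
      then show "?w (Suc i) \<in> closed_nbhd G {?w i}"
        by cases (use w' u(2) in \<open>auto simp: robber_walk_def closed_nbhd_def\<close>)
    qed
    moreover have "?C j (?w j)" if "j \<le> Suc n" for j
    proof (cases "j \<le> n")
      case True
      then show ?thesis using w'(3) by simp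
    next
      case False
      with that have "j = Suc n" by simp
      then show ?thesis using v(2) by simp
    qed
    ultimately show "v \<in> {w' (Suc n) | w'. robber_walk G w' \<and> (\<forall>j\<le>Suc n. ?C j (w' j))}"
      by (intro CollectI exI[of _ ?w]) auto
  next
    fix v assume "v \<in> {w' (Suc n) | w'. robber_walk G w' \<and> (\<forall>j\<le>Suc n. ?C j (w' j))}"
    then obtain w' where w': "v = w' (Suc n)" "robber_walk G w'" "\<forall>j\<le>Suc n. ?C j (w' j)"
      by blast
    have "\<forall>j\<le>n. ?C j (w' j)" using w'(3) by (meson le_SucI)
    with w'(2) have "w' n \<in> ?R n" unfolding Suc.IH by blast
    moreover have "v \<in> closed_nbhd G {w' n}" using w' by (simp add: robber_walk_def)
    ultimately have "v \<in> closed_nbhd G (?R n)" by (auto simp: closed_nbhd_def)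
    moreover have "?C (Suc n) v" using w' by blast
    ultimately show "v \<in> ?R (Suc n)" unfolding R by blast
  qed
qed

end

theory Submission
  imports Defs
begin

text \<open>
  If the strategy graph is finite, a robber who is never located would trace an infinite branch.
  Conversely, an infinite strategy graph should yield an escaping robber. An infinite branch alone
  is not enough, since the robber sets along it must still be threaded by one walk. We therefore
  apply Koenig's lemma not to states but to pairs of a state and a position of the robber in its
  robber set: every state of the strategy graph is reached by such pairs, the branching is finite,
  and an infinite branch is a play in which the robber is never located.
\<close>

text \<open>If infinitely many pairs lie below a point, finite branching leaves infinitely many
  below one of its successors, and dependent choice iterates this. Recording the length along with
  the endpoint makes a cycle count as infinite, so \<open>R\<close> may have cycles.\<close>

lemma koenig_chain:
  fixes R :: "('a \<times> 'a) set"
  assumes fin: "\<And>y. finite (R `` {y})"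
    and inf: "infinite {(n, y). (x, y) \<in> R ^^ n}"
  obtains f where "f 0 = x" "\<And>i. (f i, f (Suc i)) \<in> R"
proof -
  define D where "D x = {(n, y). (x, y) \<in> R ^^ n}" for x
  have D: "D x \<subseteq> insert (0, x) (\<Union>y\<in>R `` {x}. (\<lambda>(n, z). (Suc n, z)) ` D y)" for x
  proof
    fix p assume "p \<in> D x"
    then obtain n z where p: "p = (n, z)" "(x, z) \<in> R ^^ n" by (auto simp: D_def)
    show "p \<in> insert (0, x) (\<Union>y\<in>R `` {x}. (\<lambda>(n, z). (Suc n, z)) ` D y)"
    proof (cases n)
      case 0
      then show ?thesis using p by simp
    next
      case (Suc m)
      with p(2) obtain y where "(x, y) \<in> R" "(y, z) \<in> R ^^ m" by (metis relpow_Suc_D2)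
      then show ?thesis using p(1) Suc by (force simp: D_def)
    qed
  qed
  have succ: "\<exists>y. infinite (D y) \<and> (x, y) \<in> R" if "infinite (D x)" for x
  proof (rule ccontr)
    assume "\<not> ?thesis"
    then have "finite (insert (0, x) (\<Union>y\<in>R `` {x}. (\<lambda>(n, z). (Suc n, z)) ` D y))"
      using fin by blast
    then show False using that finite_subset[OF D] by simp
  qed
  \<comment> \<open>The clause for \<open>i = 0\<close> pins the start of the chosen sequence to
    \<open>x\<close>.\<close>
  have "\<exists>f. \<forall>i. (infinite (D (f i)) \<and> (i = 0 \<longrightarrow> f i = x)) \<and> (f i, f (Suc i)) \<in> R"
    using inf succ by (intro dependent_nat_choice) (auto simp: D_def)
  then show ?thesis using that by blast
qed

lemma closed_nbhd_mono: "S \<subseteq> T \<Longrightarrow> closed_nbhd G S \<subseteq> closed_nbhd G T"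
  by (auto simp: closed_nbhd_def)

text \<open>A valid label comes from an actual position, and that position survives in the child's
  robber set.\<close>

lemma strategy_graph_robber_set:
  assumes "wf_digraph G" "verts G \<noteq> {}" "(i, \<phi>) \<in> strategy_graph_verts G m0 upd A"
  shows "robber_set \<phi> \<noteq> {} \<and> robber_set \<phi> \<subseteq> verts G"
  using assms(3)
proof (induction rule: strategy_graph_verts.induct)
  case root
  then show ?case using assms(2) by (simp add: initial_state_def)
next
  case (child i \<phi> r)
  have "extended_robber_set G \<phi> \<subseteq> verts G"
    using child.IH closed_nbhd_mono closed_nbhd_verts[OF assms(1)]
    unfolding extended_robber_set_def by metis
  then show ?case using child.hyps by (auto simp: next_state_def valid_results_def)
qed

text \<open>The vertex in a pair is the robber's position at the latest probe; the move to
  \<open>v\<close> comes first, then \<open>v\<close> is probed. The results are computed from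
  \<open>v\<close>, so every chain of pairs is an actual play.\<close>

definition round_rel ::
    "('v, 'e) pre_digraph \<Rightarrow> ('v, 'm) info_update \<Rightarrow> ('v, 'm) strategy \<Rightarrow>
      ((('v, 'm) state \<times> 'v) \<times> (('v, 'm) state \<times> 'v)) set" where
  "round_rel G upd A =
    {((\<phi>, u), (next_state G upd A \<phi> (probe_results G (A \<phi>) v), v)) | \<phi> u v.
      \<not> terminating \<phi> \<and> v \<in> closed_nbhd G {u}}"

lemma finite_round_rel_successors:
  assumes "fin_digraph G"
  shows "finite (round_rel G upd A `` {p})"
proof -
  obtain \<phi> u where p: "p = (\<phi>, u)" by force
  interpret fin_digraph G by fact
  \<comment> \<open>The pair is arbitrary, so \<open>u\<close> may lie outside
    \<open>verts G\<close>, yet it always belongs to its own closed neighbourhood.\<close>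
  have "closed_nbhd G {u} \<subseteq> insert u (verts G)"
    by (auto simp: closed_nbhd_def dest: adj_in_verts)
  then have "finite (closed_nbhd G {u})" by (rule finite_subset) simp
  moreover have "round_rel G upd A `` {p} \<subseteq>
      (\<lambda>v. (next_state G upd A \<phi> (probe_results G (A \<phi>) v), v)) ` closed_nbhd G {u}"
    by (auto simp: round_rel_def p)
  ultimately show ?thesis by (meson finite_imageI finite_subset)
qed

text \<open>A position in a child's robber set is reached from some position in the parent's, and
  its own probe results are the label of the edge. Tracing back in this way leads to the
  root.\<close>

lemma strategy_graph_round_rel:
  assumes "(i, \<phi>) \<in> strategy_graph_verts G m0 upd A" "v \<in> robber_set \<phi>"
  shows "\<exists>u\<in>verts G. ((initial_state G m0, u), (\<phi>, v)) \<in> round_rel G upd A ^^ i"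
  using assms
proof (induction arbitrary: v rule: strategy_graph_verts.induct)
  case root
  then show ?case by (auto simp: initial_state_def)
next
  case (child i \<phi> r)
  then have v: "v \<in> closed_nbhd G (robber_set \<phi>)" "probe_results G (A \<phi>) v = r"
    by (auto simp: next_state_def extended_robber_set_def)
  then obtain u where u: "u \<in> robber_set \<phi>" "v \<in> closed_nbhd G {u}"
    by (auto simp: closed_nbhd_def)
  then have "((\<phi>, u), (next_state G upd A \<phi> r, v)) \<in> round_rel G upd A"
    using child.hyps v(2) by (auto simp: round_rel_def)
  then show ?case using child.IH[OF u(1)] by (meson relpow_Suc_I)
qed

lemma round_rel_chain_play:
  assumes G: "wf_digraph G" and u: "u \<in> verts G"
    and f: "f 0 = (initial_state G m0, u)" "\<And>i. (f i, f (Suc i)) \<in> round_rel G upd A"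
  shows "\<not> cop_winning G m0 upd A"
proof -
  \<comment> \<open>The shift by one: \<open>w i\<close> is probed in round \<open>i + 1\<close>,
    whereas the vertex in \<open>f 0\<close> is an auxiliary position before the first move.\<close>
  define w where "w i = snd (f (Suc i))" for i
  have step: "\<not> terminating (fst (f i))" "snd (f (Suc i)) \<in> closed_nbhd G {snd (f i)}"
    "fst (f (Suc i)) =
      next_state G upd A (fst (f i)) (probe_results G (A (fst (f i))) (snd (f (Suc i))))" for i
    using f(2)[of i] by (auto simp: round_rel_def)
  have "w 0 \<in> closed_nbhd G {u}" using step(2)[of 0] f(1) by (simp add: w_def)
  then have "w 0 \<in> verts G"
    using closed_nbhd_mono[of "{u}" "verts G"] closed_nbhd_verts[OF G] u by auto
  then have walk: "robber_walk G w" using step(2) by (simp add: robber_walk_def w_def)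
  have "play_state G m0 upd A w i = fst (f i)" for i
    by (induction i) (simp_all add: f(1) step(3) w_def Let_def)
  then show ?thesis using walk step(1) by (auto simp: cop_winning_def terminating_def)
qed

text \<open>The second conjunct carries the induction: since the true position lies in the extended
  robber set, its probe results are valid and label an edge.\<close>

lemma play_state_in_strategy_graph:
  assumes G: "wf_digraph G" and w: "robber_walk G w"
    and nt: "\<And>i. \<not> terminating (play_state G m0 upd A w i)"
  shows "(i, play_state G m0 upd A w i) \<in> strategy_graph_verts G m0 upd A \<and>
    w i \<in> extended_robber_set G (play_state G m0 upd A w i)"
proof (induction i)
  case 0
  show ?case
    using w closed_nbhd_verts[OF G] strategy_graph_verts.root[of G m0 upd A]
    by (simp add: robber_walk_def extended_robber_set_def initial_state_def)
next
  case (Suc i)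
  let ?\<phi> = "play_state G m0 upd A w i"
  have "w i \<in> robber_set (play_state G m0 upd A w (Suc i))"
    using Suc.IH by (simp add: next_state_def Let_def)
  moreover have "w (Suc i) \<in> closed_nbhd G {w i}" using w by (simp add: robber_walk_def)
  ultimately have "w (Suc i) \<in> extended_robber_set G (play_state G m0 upd A w (Suc i))"
    unfolding extended_robber_set_def
    using closed_nbhd_mono[of "{w i}"] by (metis bot.extremum insert_subset subsetD)
  moreover have "probe_results G (A ?\<phi>) (w i) \<in> valid_results G A ?\<phi>"
    using Suc.IH by (simp add: valid_results_def)
  ultimately show ?case
    using Suc.IH nt[of i] by (simp add: Let_def strategy_graph_verts.child)
qed

lemma finite_strategy_graph_verts:
  assumes G: "fin_digraph G" and ne: "verts G \<noteq> {}" and win: "cop_winning G m0 upd A"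
  shows "finite (strategy_graph_verts G m0 upd A)"
proof -
  interpret fin_digraph G by fact
  \<comment> \<open>One tree of pairs for each of the finitely many starting vertices.\<close>
  define D where "D u = {(n, p). ((initial_state G m0, u), p) \<in> round_rel G upd A ^^ n}" for u
  have "finite (D u)" if "u \<in> verts G" for u
  proof (rule ccontr)
    assume "infinite (D u)"
    then obtain f where "f 0 = (initial_state G m0, u)" "\<And>i. (f i, f (Suc i)) \<in> round_rel G upd A"
      unfolding D_def by (rule koenig_chain[OF finite_round_rel_successors[OF G]]) blast
    then have "\<not> cop_winning G m0 upd A" by (rule round_rel_chain_play[OF wf_digraph_axioms that])
    then show False using win by contradiction
  qed
  then have "finite ((\<lambda>(n, p). (n, fst p)) ` (\<Union>u\<in>verts G. D u))" by simp
  moreover have "strategy_graph_verts G m0 upd A \<subseteq> (\<lambda>(n, p). (n, fst p)) ` (\<Union>u\<in>verts G. D u)"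
  proof (rule subrelI)
    fix i \<phi> assume i: "(i, \<phi>) \<in> strategy_graph_verts G m0 upd A"
    \<comment> \<open>A nonempty robber set is what lifts a state to a pair, so projecting the trees
      covers all states.\<close>
    obtain v where "v \<in> robber_set \<phi>"
      using strategy_graph_robber_set[OF wf_digraph_axioms ne i] by blast
    then obtain u where "u \<in> verts G" "(i, (\<phi>, v)) \<in> D u"
      using strategy_graph_round_rel[OF i] unfolding D_def by blast
    then show "(i, \<phi>) \<in> (\<lambda>(n, p). (n, fst p)) ` (\<Union>u\<in>verts G. D u)" by force
  qed
  ultimately show ?thesis by (rule rev_finite_subset)
qed

text \<open>An arc is determined by its source and its label, and the labels at a state are the
  results of finitely many positions.\<close>

lemma fin_digraph_cop_strategy_graph:
  assumes G: "fin_digraph G" and ne: "verts G \<noteq> {}"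
    and fin: "finite (strategy_graph_verts G m0 upd A)"
  shows "fin_digraph (cop_strategy_graph G m0 upd A)"
proof
  interpret fin_digraph G by fact
  let ?H = "cop_strategy_graph G m0 upd A" and ?V = "strategy_graph_verts G m0 upd A"
  show "tail ?H e \<in> verts ?H" "head ?H e \<in> verts ?H" if "e \<in> arcs ?H" for e
    using that by (auto simp: cop_strategy_graph_def intro: strategy_graph_verts.child)
  show "finite (verts ?H)" using fin by (simp add: cop_strategy_graph_def)
  have "finite (valid_results G A \<phi>)" if "(i, \<phi>) \<in> ?V" for i \<phi>
  proof -
    have "extended_robber_set G \<phi> \<subseteq> verts G"
      using strategy_graph_robber_set[OF wf_digraph_axioms ne that] closed_nbhd_mono
        closed_nbhd_verts[OF wf_digraph_axioms]
      unfolding extended_robber_set_def by metis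
    then have "finite (extended_robber_set G \<phi>)" by (rule finite_subset) simp
    then show ?thesis by (simp add: valid_results_def)
  qed
  then have "finite (SIGMA p:?V. valid_results G A (snd p))"
    using fin by (intro finite_SigmaI) auto
  moreover have "arcs ?H \<subseteq> (\<lambda>((i, \<phi>), r). ((i, \<phi>), r, (Suc i, next_state G upd A \<phi> r))) `
      (SIGMA p:?V. valid_results G A (snd p))"
    by (force simp: cop_strategy_graph_def)
  ultimately show "finite (arcs ?H)" by (meson finite_imageI finite_subset)
qed

text \<open>A robber who is never located visits a vertex on every level. The level tags keep these
  vertices distinct even when states repeat.\<close>

lemma cop_winning_if_finite_verts:
  assumes G: "wf_digraph G" and fin: "finite (strategy_graph_verts G m0 upd A)"
  shows "cop_winning G m0 upd A"
proof (rule ccontr)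
  assume "\<not> cop_winning G m0 upd A"
  then obtain w where w: "robber_walk G w"
    and nt: "\<And>i. i \<ge> 1 \<Longrightarrow> \<not> terminating (play_state G m0 upd A w i)"
    by (auto simp: cop_winning_def terminating_def)
  \<comment> \<open>On a one-vertex graph the root is a leaf, but the cops win only after probing once.\<close>
  have "\<not> terminating (play_state G m0 upd A w 0)"
  proof
    assume "terminating (play_state G m0 upd A w 0)"
    then obtain v where "verts G = {v}"
      by (auto simp: terminating_def initial_state_def card_1_singleton_iff)
    then have "robber_set (play_state G m0 upd A w (Suc 0)) = {v}"
      using closed_nbhd_verts[OF G] w
      by (auto simp: next_state_def extended_robber_set_def initial_state_def robber_walk_def
          Let_def)
    then show False using nt[of 1] by (simp add: terminating_def)
  qed
  then have "\<not> terminating (play_state G m0 upd A w i)" for i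
    using nt[of i] by (cases i) auto
  from play_state_in_strategy_graph[OF G w this]
  have "range (\<lambda>i. (i, play_state G m0 upd A w i)) \<subseteq> strategy_graph_verts G m0 upd A" by blast
  then have "finite (range (\<lambda>i. (i, play_state G m0 upd A w i)))" using fin finite_subset by blast
  then show False by (rule notE[OF range_inj_infinite, rotated]) (simp add: inj_on_def)
qed

theorem theorem1:
  fixes G :: "('v, 'e) pre_digraph"
    and k :: nat
    and m0 :: 'm
    and upd :: "('v, 'm) info_update"
    and A :: "('v, 'm) strategy"
  assumes "graph G"
    and "Digraph_Component.connected G"
    and "cop_strategy G k A"
  shows "cop_winning G m0 upd A \<longleftrightarrow> fin_digraph (cop_strategy_graph G m0 upd A)"
proof
  interpret graph G by fact
  have ne: "verts G \<noteq> {}"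
    using assms(2) by (auto simp: connected_def strongly_connected_def)
  show "fin_digraph (cop_strategy_graph G m0 upd A)" if "cop_winning G m0 upd A"
    by (intro fin_digraph_cop_strategy_graph finite_strategy_graph_verts fin_digraph_axioms ne that)
  show "cop_winning G m0 upd A" if "fin_digraph (cop_strategy_graph G m0 upd A)"
    using cop_winning_if_finite_verts[OF wf_digraph_axioms] fin_digraph.finite_verts[OF that]
    by (simp add: cop_strategy_graph_def)
qed

end
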